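(* There is an absolute constant $C>0$ such that the following holds. Let $A\subset\mathbb{R}$ be a finite set with $|A|\ge 2$, let $M\ge 1$, and suppose that $|AA|\le M|A|$ or $|A/A|\le M|A|$. Then: (i) for every real $\alpha\neq0$, $\mathsf{E}^\times(A+\alpha)\le C M^4|A|^2\log|A|$; (ii) $|AA+A+A|\ge|(A+1)(A+1)|\ge C^{-1}\dfrac{|A|^2}{M^4\log|A|}$; (iii) for all real $\alpha,\beta\neq0$, $|A+\alpha A+\beta A|\ge C^{-1}\dfrac{|A|^2}{M^6\log|A|}$.
   Context: $AA=\{ab:a,b\in A\}$, $A/A=\{a/b:a,b\in A,\ b\ne0\}$, $A+\alpha=\{a+\alpha:a\in A\}$, $\alpha A=\{\alpha a: a\in A\}$, $X+Y=\{x+y\}$, $XY=\{xy\}$. The multiplicative energy of a finite set $X\subset\mathbb{R}$ is $\mathsf{E}^\times(X)=|\{(x_1,x_2,x_3,x_4)\in X^4: x_1x_2=x_3x_4\}|$. Logarithms are base 2. *)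

theory Defs
  imports Complex_Main "HOL-Library.Set_Algebras"
begin

text \<open>
  For sets, \<open>A + B\<close> and \<open>A * B\<close> are the elementwise sum and product sets, \<open>a +o A\<close> is the
  translate of \<open>A\<close> by \<open>a\<close>, and \<open>a *o A\<close> is its dilate by \<open>a\<close>.  In \<open>ratio_set\<close>, zero
  denominators are excluded explicitly because division by \<open>0\<close> yields \<open>0\<close> in HOL.
\<close>

definition ratio_set :: "'a::field set \<Rightarrow> 'a set \<Rightarrow> 'a set" where
  "ratio_set A B = {a / b | a b. a \<in> A \<and> b \<in> B \<and> b \<noteq> 0}"

definition mult_energy :: "'a::times set \<Rightarrow> nat" where
  "mult_energy X =
     card {(x1, x2, x3, x4). x1 \<in> X \<and> x2 \<in> X \<and> x3 \<in> X \<and> x4 \<in> X \<and> x1 * x2 = x3 * x4}"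

end

theory Submission
  imports Defs "HOL-Analysis.Convex"
begin

text \<open>
  Let \<open>P\<close> be the set of nonzero elements of \<open>A\<close>, or of their inverses, so that \<open>|A P| \<le> M |A|\<close>.
  If \<open>c\<close> is a ratio with at least \<open>t\<close> representations in \<open>A + \<alpha>\<close>, then through each of the
  \<open>|P|\<^sup>2\<close> points of \<open>(- \<alpha> P) \<times> (- \<alpha> P)\<close> there passes a line, with slope determined by \<open>c\<close>, that
  contains \<open>t\<close> points of the grid \<open>(A P) \<times> (A P)\<close>.  A Szemeredi--Trotter bound for Cartesian
  products, which has an elementary proof using the order of the reals, shows that there are
  \<open>O(M\<^sup>4 |A|\<^sup>2 / t\<^sup>2)\<close> such ratios, and summing over \<open>t\<close> gives (i).  Parts (ii) and (iii) follow by
  Cauchy--Schwarz; for (iii) one picks \<open>z\<close> such that \<open>u v / z \<in> A\<close> for many pairs \<open>(u, v)\<close> in \<open>A\<close> and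
  uses \<open>u v / z + \<alpha> u + \<beta> v = (u + \<beta> z) (v + \<alpha> z) / z - \<alpha> \<beta> z\<close>.
\<close>

section \<open>Gaps between consecutive elements of finite sets of reals\<close>

text \<open>Both orders of the endpoints are allowed because a line of negative slope reverses them.\<close>

definition between :: "real set \<Rightarrow> real \<Rightarrow> real \<Rightarrow> real set" where
  "between X x y = {z \<in> X. x < z \<and> z \<le> y \<or> y \<le> z \<and> z < x}"

text \<open>If \<open>y\<close> is the farthest such element above \<open>x\<close>, all the others
  above \<open>x\<close> lie in \<open>between X x y\<close>, which contains \<open>y\<close> but
  not \<open>x\<close>. So there are at most \<open>K\<close> of them, and likewise below.\<close>

lemma card_near_le:
  assumes "finite X" and K: "K \<ge> 0"
  shows "real (card {y \<in> X. y \<noteq> x \<and> real (card (between X x y)) \<le> K}) \<le> 2 * K" (is "real (card ?N) \<le> _")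
proof -
  let ?U = "{y \<in> ?N. x < y}" and ?D = "{y \<in> ?N. y < x}"
  have fin: "finite ?U" "finite ?D" using assms by auto
  have "real (card ?U) \<le> K"
  proof (cases "?U = {}")
    case False
    then have M: "Max ?U \<in> ?U" using fin by (intro Max_in)
    have "?U \<subseteq> between X x (Max ?U)" using fin by (auto simp: between_def intro!: Max_ge)
    then have "card ?U \<le> card (between X x (Max ?U))"
      using assms by (intro card_mono) (auto simp: between_def)
    then show ?thesis using M by force
  qed (use K in \<open>simp only: card.empty of_nat_0\<close>)
  moreover have "real (card ?D) \<le> K"
  proof (cases "?D = {}")
    case False
    then have M: "Min ?D \<in> ?D" using fin by (intro Min_in)
    have "?D \<subseteq> between X x (Min ?D)" using fin by (auto simp: between_def intro!: Min_le)
    then have "card ?D \<le> card (between X x (Min ?D))"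
      using assms by (intro card_mono) (auto simp: between_def)
    then show ?thesis using M by force
  qed (use K in \<open>simp only: card.empty of_nat_0\<close>)
  moreover have "card ?N \<le> card (?U \<union> ?D)" using fin by (intro card_mono) auto
  moreover have "card (?U \<union> ?D) \<le> card ?U + card ?D" by (rule card_Un_le)
  ultimately show ?thesis by linarith
qed

text \<open>At the maximum of \<open>S\<close> this is the unspecified \<open>Min {}\<close>, so
  gaps are indexed by \<open>S - {Max S}\<close>.\<close>

definition succ_in :: "real set \<Rightarrow> real \<Rightarrow> real" where
  "succ_in S x = Min {y \<in> S. x < y}"

lemma succ_in:
  assumes "finite S" "x \<in> S - {Max S}"
  shows "succ_in S x \<in> S" "x < succ_in S x"
proof -
  have "Max S \<in> S" using assms by (intro Max_in) auto
  moreover have "x \<le> Max S" using assms by auto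

  ultimately have "Max S \<in> {y \<in> S. x < y}" using assms by (auto simp del: Max_ge)
  then have "succ_in S x \<in> {y \<in> S. x < y}"
    unfolding succ_in_def using assms by (intro Min_in) auto
  then show "succ_in S x \<in> S" "x < succ_in S x" by auto
qed

lemma succ_in_le: "finite S \<Longrightarrow> y \<in> S \<Longrightarrow> x < y \<Longrightarrow> succ_in S x \<le> y"
  unfolding succ_in_def by (intro Min_le) auto

text \<open>Half-open gaps between consecutive elements are pairwise disjoint.\<close>

lemma sum_gaps_le:
  assumes "finite S" "finite X"
  shows "(\<Sum>x\<in>S - {Max S}. card (between X x (succ_in S x))) \<le> card X"
proof -
  have "(\<Sum>x\<in>S - {Max S}. card (between X x (succ_in S x)))
      = card (\<Union>x\<in>S - {Max S}. between X x (succ_in S x))"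
  proof (intro card_UN_disjoint[symmetric] ballI impI)
    fix x y assume xy: "x \<in> S - {Max S}" "y \<in> S - {Max S}" "x \<noteq> y"
    then consider "succ_in S x \<le> y" | "succ_in S y \<le> x"
      using succ_in_le[OF assms(1)] by (meson DiffD1 linorder_neqE)
    then show "between X x (succ_in S x) \<inter> between X y (succ_in S y) = {}"
      using succ_in[OF assms(1) xy(1)] succ_in[OF assms(1) xy(2)]
      by cases (auto simp: between_def)
  qed (use assms in \<open>auto simp: between_def\<close>)
  also have "\<dots> \<le> card X" using assms by (intro card_mono) (auto simp: between_def)
  finally show ?thesis .
qed

text \<open>Markov's inequality for the gap sizes.\<close>

lemma card_wide_gaps_le:
  assumes "finite S" "finite X" "K > 0"
  shows "real (card {x \<in> S - {Max S}. real (card (between X x (succ_in S x))) > K}) * K \<le> real (card X)"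
    (is "real (card ?W) * K \<le> _")
proof -
  have "real (card ?W) * K = (\<Sum>x\<in>?W. K)" by simp
  also have "\<dots> \<le> (\<Sum>x\<in>?W. real (card (between X x (succ_in S x))))" by (intro sum_mono) auto
  also have "\<dots> \<le> (\<Sum>x\<in>S - {Max S}. real (card (between X x (succ_in S x))))"
    using assms by (intro sum_mono2) auto
  also have "\<dots> \<le> real (card X)" using sum_gaps_le[OF assms(1,2)] by (metis of_nat_mono of_nat_sum)
  finally show ?thesis .
qed

section \<open>A Szemeredi--Trotter bound for rich lines in a Cartesian product\<close>

text \<open>An affine map of nonzero slope keeps or reverses the order, and \<open>between\<close>
  drops the first endpoint and keeps the second in either direction. Gaps in the second coordinate
  of a line can thus be counted along its abscissas.\<close>

lemma card_between_affine:
  assumes "m \<noteq> 0"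
  shows "card (between ((\<lambda>w. (w - b) / m) ` Y) x y) = card (between Y (m * x + b) (m * y + b))"
proof -
  have "x < (w - b) / m \<and> (w - b) / m \<le> y \<or> y \<le> (w - b) / m \<and> (w - b) / m < x \<longleftrightarrow>
      m * x + b < w \<and> w \<le> m * y + b \<or> m * y + b \<le> w \<and> w < m * x + b" for w
    using assms by (cases "m > 0") (auto simp: field_simps)
  then have "between ((\<lambda>w. (w - b) / m) ` Y) x y = (\<lambda>w. (w - b) / m) ` between Y (m * x + b) (m * y + b)"
    unfolding between_def by blast
  moreover have "inj (\<lambda>w. (w - b) / m)" using assms by (auto simp: inj_def)
  ultimately show ?thesis by (simp add: card_image inj_on_subset)
qed

text \<open>The pair \<open>(m, b)\<close> encodes the line y = m x + b, and a point on it is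
  recorded by its abscissa alone.\<close>

definition line_pts :: "real set \<Rightarrow> real set \<Rightarrow> real \<times> real \<Rightarrow> real set" where
  "line_pts X Y l = {x \<in> X. fst l * x + snd l \<in> Y}"

lemma finite_line_pts: "finite X \<Longrightarrow> finite (line_pts X Y l)"
  by (simp add: line_pts_def)

text \<open>Closeness is measured by rank within \<open>X\<close>, not by distance.\<close>

definition close_pairs :: "real set \<Rightarrow> real \<Rightarrow> (real \<times> real) set" where
  "close_pairs X K = (SIGMA x:X. {y \<in> X. y \<noteq> x \<and> real (card (between X x y)) \<le> K})"

lemma finite_close_pairs: "finite X \<Longrightarrow> finite (close_pairs X K)"
  by (simp add: close_pairs_def)

lemma card_close_pairs_le:
  assumes "finite X" "K \<ge> 0"
  shows "real (card (close_pairs X K)) \<le> 2 * K * real (card X)"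
proof -
  have "real (card (close_pairs X K))
      = (\<Sum>x\<in>X. real (card {y \<in> X. y \<noteq> x \<and> real (card (between X x y)) \<le> K}))"
    using assms by (simp add: close_pairs_def)
  also have "\<dots> \<le> (\<Sum>x\<in>X. 2 * K)" using assms by (intro sum_mono card_near_le)
  finally show ?thesis by (simp add: mult.commute)
qed

text \<open>By Markov, at most n / K = t / 8 gaps are wide in each coordinate. So at least |S| - 1 -
  t / 4 consecutive pairs are close in both, and this is at least |S| / 4 because 1 \<le> t / 2 and
  t \<le> |S|.\<close>

lemma card_line_pts_le_close:
  fixes X Y :: "real set" and n t :: real and l :: "real \<times> real"
  defines "S \<equiv> line_pts X Y l" and "K \<equiv> 8 * n / t"
  assumes fin: "finite X" "finite Y" and n: "real (card X) \<le> n" "real (card Y) \<le> n"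
    and l: "fst l \<noteq> 0" and t: "2 \<le> t" "t \<le> real (card S)"
  shows "real (card S) \<le> 4 * real (card {x \<in> S - {Max S}.
      (x, succ_in S x) \<in> close_pairs X K \<and>
      (fst l * x + snd l, fst l * succ_in S x + snd l) \<in> close_pairs Y K})"
proof -
  obtain m b where mb: "l = (m, b)" by (cases l)
  have m: "m \<noteq> 0" using l mb by simp
  \<comment> \<open>\<open>Y'\<close> is \<open>Y\<close> pulled back along the line to
    abscissas.\<close>
  define Y' where "Y' = (\<lambda>w. (w - b) / m) ` Y"
  define W where "W Z = {x \<in> S - {Max S}. real (card (between Z x (succ_in S x))) > K}" for Z
  define G where "G = {x \<in> S - {Max S}. (x, succ_in S x) \<in> close_pairs X K \<and>
      (m * x + b, m * succ_in S x + b) \<in> close_pairs Y K}"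
  have finS: "finite S" unfolding S_def using fin by (rule_tac finite_line_pts)
  have SX: "S \<subseteq> X" by (auto simp: S_def line_pts_def)
  have "n > 0"
  proof -
    have "card S \<le> card X" using SX fin by (intro card_mono)
    then show ?thesis using n t by linarith
  qed
  then have K: "K > 0" unfolding K_def using t by simp
  have finY': "finite Y'" using fin by (simp add: Y'_def)
  have cY': "real (card Y') \<le> n"
    using card_image_le[OF fin(2), of "\<lambda>w. (w - b) / m"] n(2) by (simp add: Y'_def)
  have W: "real (card (W Z)) \<le> t / 8" if "finite Z" "real (card Z) \<le> n" for Z
  proof -
    have "real (card (W Z)) * K \<le> n"
      using card_wide_gaps_le[OF finS that(1) K] that(2) by (simp add: W_def)
    then show ?thesis using \<open>n > 0\<close> t by (simp add: K_def field_simps)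
  qed
  have "S - {Max S} \<subseteq> W X \<union> W Y' \<union> G"
  proof
    fix x assume x: "x \<in> S - {Max S}"
    note s = succ_in[OF finS x]
    have "m * x + b \<in> Y" "m * succ_in S x + b \<in> Y"
      using x s(1) by (auto simp: S_def line_pts_def mb)
    moreover have "x \<in> X" "succ_in S x \<in> X" using x s(1) SX by auto
    ultimately show "x \<in> W X \<union> W Y' \<union> G"
      using x s(2) m card_between_affine[OF m, of b Y x "succ_in S x"]
      by (auto simp: W_def G_def Y'_def close_pairs_def not_less)
  qed
  then have "card (S - {Max S}) \<le> card (W X \<union> W Y' \<union> G)"
    using finS by (intro card_mono) (auto simp: W_def G_def)
  also have "\<dots> \<le> card (W X) + card (W Y') + card G"
    using card_Un_le[of "W X \<union> W Y'" G] card_Un_le[of "W X" "W Y'"] by linarith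
  finally have "real (card (S - {Max S})) \<le> t / 8 + t / 8 + real (card G)"
    using W[OF fin(1) n(1)] W[OF finY' cY'] by linarith
  moreover have "card S \<le> card (S - {Max S}) + 1" using diff_card_le_card_Diff[of "{Max S}" S] by simp
  ultimately have "real (card S) \<le> 4 * real (card G)" using t by linarith
  then show ?thesis by (simp add: G_def mb)
qed

text \<open>Elekes' gap argument: on a rich line most consecutive points are close in both coordinates,
  and a pair of distinct points lies on at most one line.\<close>

lemma sum_rich_lines_le:
  fixes n t :: real and L :: "(real \<times> real) set"
  assumes fin: "finite X" "finite Y" "finite L" and n: "real (card X) \<le> n" "real (card Y) \<le> n"
    and L: "\<And>l. l \<in> L \<Longrightarrow> fst l \<noteq> 0" and t: "2 \<le> t"
    and rich: "\<And>l. l \<in> L \<Longrightarrow> t \<le> real (card (line_pts X Y l))"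
  shows "(\<Sum>l\<in>L. real (card (line_pts X Y l))) \<le> 1024 * n ^ 4 / t\<^sup>2"
proof -
  define K where "K = 8 * n / t"
  have "n \<ge> 0" using n by linarith
  then have K: "K \<ge> 0" using t by (simp add: K_def)
  let ?S = "line_pts X Y"
  define G where "G l = {x \<in> ?S l - {Max (?S l)}. (x, succ_in (?S l) x) \<in> close_pairs X K \<and>
      (fst l * x + snd l, fst l * succ_in (?S l) x + snd l) \<in> close_pairs Y K}" for l
  have finG: "finite (G l)" for l using finite_line_pts[OF fin(1)] by (simp add: G_def)
  define f where "f = (\<lambda>(l, x). ((x, succ_in (?S l) x),
      (fst l * x + snd l, fst l * succ_in (?S l) x + snd l)))"
  have inj: "inj_on f (SIGMA l:L. G l)"
  proof (rule inj_onI)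
    fix z z' assume z: "z \<in> (SIGMA l:L. G l)" and eq: "f z = f z'"
    obtain m b x m' b' x' where zz: "z = ((m, b), x)" "z' = ((m', b'), x')"
      by (metis surj_pair)
    define y where "y = succ_in (?S (m, b)) x"
    have "x \<in> ?S (m, b) - {Max (?S (m, b))}" using z by (simp add: zz G_def)
    then have xy: "x < y" unfolding y_def by (rule succ_in(2)[OF finite_line_pts[OF fin(1)]])
    note e = eq[unfolded zz f_def prod.case fst_conv snd_conv prod.inject, folded y_def]
    then have x: "x' = x" and y: "y = succ_in (?S (m', b')) x'" by blast+
    have l: "m * x + b = m' * x + b'" "m * y + b = m' * y + b'" using e unfolding x y by blast+
    then have "(m - m') * (y - x) = 0" by (simp add: algebra_simps)
    then have "m = m'" using xy by simp
    then show "z = z'" using l x by (simp add: zz)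
  qed
  have "(\<Sum>l\<in>L. real (card (?S l))) \<le> (\<Sum>l\<in>L. 4 * real (card (G l)))"
    unfolding G_def K_def
    by (intro sum_mono card_line_pts_le_close fin n L t rich)
  also have "\<dots> = 4 * real (card (SIGMA l:L. G l))"
    using fin finG by (simp add: sum_distrib_left)
  also have "card (SIGMA l:L. G l) \<le> card (close_pairs X K \<times> close_pairs Y K)"
    using fin by (intro card_inj_on_le[OF inj]) (auto simp: f_def G_def finite_close_pairs)
  also have "real \<dots> = real (card (close_pairs X K)) * real (card (close_pairs Y K))"
    by (simp add: card_cartesian_product)
  also have "\<dots> \<le> (2 * K * n) * (2 * K * n)"
  proof (rule mult_mono)
    show "real (card (close_pairs X K)) \<le> 2 * K * n"
      using card_close_pairs_le[OF fin(1) K] n K by (meson mult_left_mono order_trans mult_nonneg_nonneg zero_le_numeral)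
    show "real (card (close_pairs Y K)) \<le> 2 * K * n"
      using card_close_pairs_le[OF fin(2) K] n K by (meson mult_left_mono order_trans mult_nonneg_nonneg zero_le_numeral)
  qed (use K \<open>n \<ge> 0\<close> in auto)
  \<comment> \<open>The factor 1024 is 16 * 64, since 4 (2 K n)^2 = 16 K^2 n^2 and K = 8 n /
    t.\<close>
  also have "4 * ((2 * K * n) * (2 * K * n)) = 1024 * n ^ 4 / t\<^sup>2"
    by (simp add: K_def power2_eq_square power4_eq_xxxx)
  finally show ?thesis by simp
qed

section \<open>Popular ratios in a translate\<close>

text \<open>If 0 is not in \<open>U\<close>, this counts the ways to write c as a quotient of two
  elements of \<open>U\<close>.\<close>

definition rep :: "real set \<Rightarrow> real \<Rightarrow> nat" where
  "rep U c = card {u \<in> U. c * u \<in> U}"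

text \<open>Dilating the ratio equation \<open>a + \<alpha> = c (a' + \<alpha>)\<close> by \<open>q\<close> in the first and \<open>p\<close> in the second
  coordinate gives a line of slope \<open>c q / p\<close> through the centre \<open>(- \<alpha> p, - \<alpha> q)\<close> that is rich in
  \<open>(A * P) \<times> (A * P)\<close>.  Lines with few centres are counted by their points in this grid, lines with
  many centres by their centres.\<close>

lemma card_popular_ratios_le:
  fixes A P T :: "real set" and M t \<alpha> :: real
  assumes fin: "finite A" "finite P" "finite T" and P0: "0 \<notin> P" and T0: "0 \<notin> T" and \<alpha>: "\<alpha> \<noteq> 0"
    and PA: "card P \<le> card A" "card A \<le> 2 * card P"
    and M: "M \<ge> 1" "real (card (A * P)) \<le> M * real (card A)"
    and t: "t \<ge> 2" and T: "\<And>c. c \<in> T \<Longrightarrow> t \<le> real (rep ((\<alpha> +o A) - {0}) c)"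
  shows "real (card T) \<le> 8192 * M ^ 4 * (real (card A))\<^sup>2 / t\<^sup>2"
proof (cases "T = {}")
  case True then show ?thesis using M by simp
next
  case False
  define a where "a = real (card A)"
  define X where "X = A * P"
  define Q where "Q = (\<lambda>p. - \<alpha> * p) ` P"
  \<comment> \<open>The line through all points ((u - \<alpha>) p, (c u - \<alpha>) q). The
    parameter u = 0 gives the centre in \<open>Q \<times> Q\<close>; each u with u and c u in the
    translate gives a point of \<open>X \<times> X\<close>.\<close>
  define line where "line = (\<lambda>(p, q, c). (c * q / p, \<alpha> * c * q - \<alpha> * q))"
  define L where "L = line ` (P \<times> P \<times> T)"
  have finX: "finite X" "finite Q" "finite L"
    using fin by (auto simp: X_def Q_def L_def finite_set_times)
  have slope: "fst l \<noteq> 0" if "l \<in> L" for l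
    using that P0 T0 by (auto simp: L_def line_def)
  have rich: "t \<le> real (card (line_pts X X l))" if "l \<in> L" for l
  proof -
    obtain p q c where pqc: "p \<in> P" "q \<in> P" "c \<in> T" and l: "l = line (p, q, c)"
      using \<open>l \<in> L\<close> by (auto simp: L_def)
    have p0: "p \<noteq> 0" using pqc P0 by auto
    have "rep ((\<alpha> +o A) - {0}) c \<le> card (line_pts X X l)"
      unfolding rep_def
    proof (rule card_inj_on_le)
      show "inj_on (\<lambda>u. (u - \<alpha>) * p) {u \<in> (\<alpha> +o A) - {0}. c * u \<in> (\<alpha> +o A) - {0}}"
        using p0 by (auto simp: inj_on_def)
      show "(\<lambda>u. (u - \<alpha>) * p) ` {u \<in> (\<alpha> +o A) - {0}. c * u \<in> (\<alpha> +o A) - {0}} \<subseteq> line_pts X X l"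
      proof (rule image_subsetI)
        fix u assume "u \<in> {u \<in> (\<alpha> +o A) - {0}. c * u \<in> (\<alpha> +o A) - {0}}"
        then have "u - \<alpha> \<in> A" "c * u - \<alpha> \<in> A" by (auto simp: elt_set_plus_def)
        then have "(u - \<alpha>) * p \<in> X" "(c * u - \<alpha>) * q \<in> X" using pqc by (auto simp: X_def)
        moreover have "fst l * ((u - \<alpha>) * p) + snd l = (c * u - \<alpha>) * q"
          using p0 by (simp add: l line_def field_simps)
        ultimately show "(u - \<alpha>) * p \<in> line_pts X X l" by (simp add: line_pts_def)
      qed
    qed (simp add: finite_line_pts finX)
    then show ?thesis using T[OF pqc(3)] by linarith
  qed
  have cQ: "card Q \<le> card A" using PA card_image_le[OF fin(2)] by (auto simp: Q_def intro: order_trans)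
  let ?s = "\<lambda>l. real (card (line_pts Q Q l))" and ?r = "\<lambda>l. real (card (line_pts X X l))"
  \<comment> \<open>Lines with at least \<open>t\<close> centres are themselves rich in the grid of
    centres.\<close>
  have many: "(\<Sum>l | l \<in> L \<and> t \<le> ?s l. ?s l) \<le> 1024 * a ^ 4 / t\<^sup>2"
    using finX cQ slope t by (intro sum_rich_lines_le) (auto simp: a_def)
  \<comment> \<open>Any other line has fewer centres than grid points, because it has at least
    \<open>t\<close> of the latter.\<close>
  have "(\<Sum>l | l \<in> L \<and> \<not> t \<le> ?s l. ?s l) \<le> (\<Sum>l | l \<in> L \<and> \<not> t \<le> ?s l. ?r l)"
    using rich by (intro sum_mono) force
  also have "\<dots> \<le> (\<Sum>l\<in>L. ?r l)" using finX by (intro sum_mono2) auto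
  also have "\<dots> \<le> 1024 * (M * a) ^ 4 / t\<^sup>2"
    using finX M(2) slope t rich by (intro sum_rich_lines_le) (auto simp: a_def X_def)
  finally have few: "(\<Sum>l | l \<in> L \<and> \<not> t \<le> ?s l. ?s l) \<le> 1024 * (M * a) ^ 4 / t\<^sup>2" .
  \<comment> \<open>The abscissa of the centre gives p, the slope then gives c q, the intercept
    gives q, and finally c. Triples are thus counted by incidences of lines with centres.\<close>
  have inj: "inj_on (\<lambda>(p, q, c). (line (p, q, c), - \<alpha> * p)) (P \<times> P \<times> T)"
  proof (rule inj_onI)
    fix z z' assume z: "z \<in> P \<times> P \<times> T" "z' \<in> P \<times> P \<times> T"
      and eq: "(\<lambda>(p, q, c). (line (p, q, c), - \<alpha> * p)) z = (\<lambda>(p, q, c). (line (p, q, c), - \<alpha> * p)) z'"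
    obtain p q c p' q' c' where zz: "z = (p, q, c)" "z' = (p', q', c')" by (metis surj_pair)
    have nz: "p \<noteq> 0" "q \<noteq> 0" "q' \<noteq> 0" using z P0 by (auto simp: zz)
    have "p = p'" using eq \<alpha> by (simp add: zz)
    moreover from this have cq: "c * q = c' * q'" using eq nz by (simp add: zz line_def)
    moreover have "\<alpha> * (c * q) - \<alpha> * q = \<alpha> * (c' * q') - \<alpha> * q'"
      using eq by (simp add: zz line_def mult.assoc)
    then have "q = q'" using cq \<alpha> by simp
    ultimately show "z = z'" using nz by (simp add: zz)
  qed
  have "card (P \<times> P \<times> T) \<le> card (SIGMA l:L. line_pts Q Q l)"
  proof (rule card_inj_on_le[OF inj])
    show "(\<lambda>(p, q, c). (line (p, q, c), - \<alpha> * p)) ` (P \<times> P \<times> T) \<subseteq> (SIGMA l:L. line_pts Q Q l)"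
    proof (rule image_subsetI)
      fix z assume "z \<in> P \<times> P \<times> T"
      then obtain p q c where z: "z = (p, q, c)" and pqc: "p \<in> P" "q \<in> P" "c \<in> T" by auto
      then have "fst (line (p, q, c)) * (- \<alpha> * p) + snd (line (p, q, c)) = - \<alpha> * q"
        using P0 by (auto simp: line_def)
      then have "- \<alpha> * p \<in> line_pts Q Q (line (p, q, c))"
        using pqc by (auto simp: Q_def line_pts_def)
      moreover have "line (p, q, c) \<in> L" using pqc by (simp add: L_def)
      ultimately show "(\<lambda>(p, q, c). (line (p, q, c), - \<alpha> * p)) z \<in> (SIGMA l:L. line_pts Q Q l)"
        by (simp add: z)
    qed
  qed (auto simp: finX finite_line_pts)
  also have "card (SIGMA l:L. line_pts Q Q l) = (\<Sum>l\<in>L. card (line_pts Q Q l))"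
    using finX by (intro card_SigmaI) (auto simp: finite_line_pts)
  finally have "real (card P) * real (card P) * real (card T) \<le> (\<Sum>l\<in>L. ?s l)"
    by (simp add: card_cartesian_product mult.assoc flip: of_nat_mult of_nat_sum)
  also have "\<dots> = (\<Sum>l | l \<in> L \<and> t \<le> ?s l. ?s l) + (\<Sum>l | l \<in> L \<and> \<not> t \<le> ?s l. ?s l)"
    using finX by (subst sum.union_disjoint[symmetric]) (auto intro: sum.cong)
  also have "\<dots> \<le> 1024 * a ^ 4 / t\<^sup>2 + 1024 * (M * a) ^ 4 / t\<^sup>2" using many few by linarith
  also have "\<dots> \<le> 1024 * (M * a) ^ 4 / t\<^sup>2 + 1024 * (M * a) ^ 4 / t\<^sup>2"
  proof -
    have "a \<le> M * a" using M mult_right_mono[of 1 M a] by (simp add: a_def)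
    then have "a ^ 4 \<le> (M * a) ^ 4" by (intro power_mono) (auto simp: a_def)
    then show ?thesis by (intro add_right_mono divide_right_mono) auto
  qed
  finally have main: "real (card P) * real (card P) * real (card T) \<le> 2048 * (M * a) ^ 4 / t\<^sup>2" by simp
  have apos: "a > 0"
  proof -
    obtain c where "c \<in> T" using False by auto
    then have "rep ((\<alpha> +o A) - {0}) c \<noteq> 0" using T[of c] t by auto
    then have "A \<noteq> {}" by (auto simp: rep_def elt_set_plus_def)
    then show ?thesis using fin by (simp add: a_def card_gt_0_iff)
  qed
  have aP: "a / 2 \<le> real (card P)" using PA by (simp add: a_def)
  \<comment> \<open>Replacing |P| by a / 2 costs a factor 4, turning 2048 into 8192.\<close>
  have "(a / 2) * (a / 2) * real (card T) \<le> real (card P) * real (card P) * real (card T)"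
    using aP apos by (intro mult_right_mono mult_mono) auto
  then have "a * a * real (card T) \<le> 4 * (2048 * (M * a) ^ 4 / t\<^sup>2)"
    using main by simp
  also have "\<dots> = a * a * (8192 * M ^ 4 * a\<^sup>2 / t\<^sup>2)"
    by (simp add: power2_eq_square power4_eq_xxxx)
  finally have "real (card T) \<le> 8192 * M ^ 4 * a\<^sup>2 / t\<^sup>2"
    by (rule mult_left_le_imp_le) (use apos in simp)
  then show ?thesis by (simp add: a_def)
qed

section \<open>Multiplicative energy of translates\<close>

text \<open>Each new term is at most an increment of ln, and ln 2 \<le> 2 converts to base 2. The
  induction starts at 2 because the logarithm vanishes at 1.\<close>

lemma sum_inverse_le_log: "N \<ge> 2 \<Longrightarrow> (\<Sum>t=1..N. 1 / real t) \<le> 2 * log 2 (real N)"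
proof (induction N rule: dec_induct)
  case base
  then show ?case by (simp add: numeral_2_eq_2)
next
  case (step N)
  have "1 / real (Suc N) \<le> ln (real (Suc N)) - ln (real N)"
    using ln_diff_le[of "real N" "real (Suc N)"] step by (simp add: field_simps)
  also have "\<dots> \<le> 2 * (log 2 (real (Suc N)) - log 2 (real N))"
  proof -
    have "ln 2 \<le> (2::real)" using ln_add_one_self_le_self[of 1] by simp
    moreover have "ln (real (Suc N)) - ln (real N) \<ge> 0" using step by simp
    ultimately have "(ln (real (Suc N)) - ln (real N)) * ln 2 \<le> (ln (real (Suc N)) - ln (real N)) * 2"
      by (intro mult_left_mono)
    then show ?thesis by (simp add: log_def field_simps)
  qed
  finally show ?case using step by simp
qed

text \<open>Layer-cake summation: n^2 is at most the sum of 2 t over t \<le> n. After swapping the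
  sums, layer t contributes at most 2 D / t.\<close>

lemma sum_squares_le_tails:
  fixes f :: "'a \<Rightarrow> nat" and D :: real
  assumes "finite T" and N: "\<And>c. c \<in> T \<Longrightarrow> f c \<le> N"
    and tail: "\<And>t. 1 \<le> t \<Longrightarrow> t \<le> N \<Longrightarrow> real (card {c \<in> T. t \<le> f c}) \<le> D / (real t)\<^sup>2"
  shows "(\<Sum>c\<in>T. (real (f c))\<^sup>2) \<le> 2 * D * (\<Sum>t=1..N. 1 / real t)"
proof -
  have sq: "(real n)\<^sup>2 \<le> (\<Sum>t=1..n. 2 * real t)" for n
    by (induction n) (auto simp: power2_eq_square algebra_simps)
  have "(\<Sum>c\<in>T. (real (f c))\<^sup>2) \<le> (\<Sum>c\<in>T. \<Sum>t=1..N. if t \<le> f c then 2 * real t else 0)"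
  proof (intro sum_mono)
    fix c assume "c \<in> T"
    then have "{1..f c} = {t \<in> {1..N}. t \<le> f c}" using N by (auto intro: order_trans)
    then show "(real (f c))\<^sup>2 \<le> (\<Sum>t=1..N. if t \<le> f c then 2 * real t else 0)"
      using sq[of "f c"] by (simp only: sum.inter_filter[OF finite_atLeastAtMost])
  qed
  also have "\<dots> = (\<Sum>t=1..N. 2 * real t * real (card {c \<in> T. t \<le> f c}))"
    using assms(1) by (subst sum.swap) (simp add: sum.inter_filter[symmetric] mult.commute)
  also have "\<dots> \<le> (\<Sum>t=1..N. 2 * real t * (D / (real t)\<^sup>2))"
    by (intro sum_mono mult_left_mono tail) auto
  also have "\<dots> = 2 * D * (\<Sum>t=1..N. 1 / real t)"
    by (simp add: sum_distrib_left power2_eq_square)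
  finally show ?thesis .
qed

text \<open>Cauchy--Schwarz over the fibres of \<open>f\<close>: |G| is the sum of their sizes, the
  number of collisions the sum of the squares.\<close>

lemma card_sq_le_collisions:
  assumes "finite G"
  shows "(real (card G))\<^sup>2 \<le> real (card (f ` G)) * real (card {(x, y). x \<in> G \<and> y \<in> G \<and> f x = f y})"
proof -
  let ?F = "\<lambda>w. {x \<in> G. f x = w}"
  have "card G = card (\<Union>w\<in>f ` G. ?F w)" by (rule arg_cong[of _ _ card]) auto
  also have "\<dots> = (\<Sum>w\<in>f ` G. card (?F w))" using assms by (intro card_UN_disjoint) auto
  finally have G: "real (card G) = (\<Sum>w\<in>f ` G. real (card (?F w)))" by simp
  have "{(x, y). x \<in> G \<and> y \<in> G \<and> f x = f y} = (\<Union>w\<in>f ` G. ?F w \<times> ?F w)" by auto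
  then have "card {(x, y). x \<in> G \<and> y \<in> G \<and> f x = f y} = card (\<Union>w\<in>f ` G. ?F w \<times> ?F w)" by simp
  also have "\<dots> = (\<Sum>w\<in>f ` G. card (?F w \<times> ?F w))" using assms by (intro card_UN_disjoint) auto
  finally have "real (card {(x, y). x \<in> G \<and> y \<in> G \<and> f x = f y}) = (\<Sum>w\<in>f ` G. (real (card (?F w)))\<^sup>2)"
    by (simp add: card_cartesian_product power2_eq_square)
  then show ?thesis
    using sum_squared_le_sum_of_squares[of "\<lambda>w. real (card (?F w))" "f ` G"] G by (simp add: mult.commute)
qed

text \<open>Two sets are needed because part (iii) multiplies elements of two different
  translates.\<close>

definition cross_energy :: "real set \<Rightarrow> real set \<Rightarrow> nat" where
  "cross_energy U V = card {(u, v, u', v'). u \<in> U \<and> v \<in> V \<and> u' \<in> U \<and> v' \<in> V \<and> u * v = u' * v'}"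

lemma mult_energy_eq_cross_energy: "mult_energy U = cross_energy U U"
  by (simp add: mult_energy_def cross_energy_def)

lemma finite_ratio_set: "finite A \<Longrightarrow> finite B \<Longrightarrow> finite (ratio_set A B)"
  by (rule finite_subset[of _ "(\<lambda>(a, b). a / b) ` (A \<times> B)"]) (auto simp: ratio_set_def)

lemma card_ratio_set_le:
  assumes "finite A" "finite B"
  shows "card (ratio_set A B) \<le> card A * card B"
proof -
  have "card (ratio_set A B) \<le> card ((\<lambda>(a, b). a / b) ` (A \<times> B))"
    using assms by (intro card_mono) (auto simp: ratio_set_def)
  also have "\<dots> \<le> card (A \<times> B)" using assms by (intro card_image_le) auto
  finally show ?thesis by (simp add: card_cartesian_product)
qed

lemma card_product_zero_le:
  fixes U V :: "real set"
  assumes "finite U" "finite V"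
  shows "card {p \<in> U \<times> V. fst p * snd p = 0} \<le> card U + card V"
proof -
  have "card {p \<in> U \<times> V. fst p * snd p = 0} \<le> card ((\<lambda>u. (u, 0::real)) ` U \<union> (\<lambda>v. (0::real, v)) ` V)"
    using assms by (intro card_mono) auto
  also have "\<dots> \<le> card ((\<lambda>u. (u, 0::real)) ` U) + card ((\<lambda>v. (0::real, v)) ` V)" by (rule card_Un_le)
  also have "\<dots> \<le> card U + card V" using assms by (intro add_mono card_image_le)
  finally show ?thesis .
qed

text \<open>If the common product is 0, both pairs lie on the coordinate axes. Otherwise c = u / u'
  = v' / v is represented in both sets, and (c, u', v) determines the quadruple.\<close>

lemma cross_energy_le:
  assumes fin: "finite U" "finite V"
  shows "cross_energy U V \<le> (card U + card V)\<^sup>2 +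
    (\<Sum>c\<in>ratio_set (U - {0}) (U - {0}). rep (U - {0}) c * rep (V - {0}) c)"
proof -
  let ?T = "ratio_set (U - {0}) (U - {0})"
  let ?Z = "{p \<in> U \<times> V. fst p * snd p = 0}"
  let ?R = "\<lambda>W c. {w \<in> W - {0::real}. c * w \<in> W - {0}}"
  define Q where "Q = {(u, v, u', v'). u \<in> U \<and> v \<in> V \<and> u' \<in> U \<and> v' \<in> V \<and> u * v = u' * v'}"
  define f where "f = (\<lambda>((u, v), (u', v')). (u::real, v::real, u'::real, v'::real))"
  define g where "g = (\<lambda>(c, u', v). (c * u'::real, v, u', c * v))"
  have "Q \<subseteq> f ` (?Z \<times> ?Z) \<union> g ` (SIGMA c:?T. ?R U c \<times> ?R V c)"
  proof
    fix q assume "q \<in> Q"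
    then obtain u v u' v' where q: "q = (u, v, u', v')" and
      mem: "u \<in> U" "v \<in> V" "u' \<in> U" "v' \<in> V" and eq: "u * v = u' * v'"
      by (auto simp: Q_def)
    show "q \<in> f ` (?Z \<times> ?Z) \<union> g ` (SIGMA c:?T. ?R U c \<times> ?R V c)"
    proof (cases "u * v = 0")
      case True
      then have "((u, v), (u', v')) \<in> ?Z \<times> ?Z" using mem eq by auto
      moreover have "q = f ((u, v), (u', v'))" by (simp add: q f_def)
      ultimately show ?thesis by blast
    next
      case False
      then have nz: "u \<noteq> 0" "v \<noteq> 0" "u' \<noteq> 0" "v' \<noteq> 0" using eq by auto
      have c: "u / u' * u' = u" "u / u' * v = v'" using nz eq by (auto simp: field_simps)
      have "u / u' \<in> ?T" using mem nz by (auto simp: ratio_set_def)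
      then have "(u / u', u', v) \<in> (SIGMA c:?T. ?R U c \<times> ?R V c)" using mem nz c by simp
      moreover have "q = g (u / u', u', v)" unfolding g_def q using c by simp
      ultimately show ?thesis by blast
    qed
  qed
  moreover have finT: "finite ?T" using fin by (intro finite_ratio_set) auto
  ultimately have "card Q \<le> card (f ` (?Z \<times> ?Z) \<union> g ` (SIGMA c:?T. ?R U c \<times> ?R V c))"
    using fin by (intro card_mono) auto
  also have "\<dots> \<le> card (f ` (?Z \<times> ?Z)) + card (g ` (SIGMA c:?T. ?R U c \<times> ?R V c))" by (rule card_Un_le)
  also have "\<dots> \<le> card (?Z \<times> ?Z) + card (SIGMA c:?T. ?R U c \<times> ?R V c)"
    using fin finT by (intro add_mono card_image_le) auto
  also have "card (?Z \<times> ?Z) \<le> (card U + card V)\<^sup>2"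
    using card_product_zero_le[OF fin] by (simp add: card_cartesian_product power2_eq_square mult_mono)
  also have "card (SIGMA c:?T. ?R U c \<times> ?R V c) = (\<Sum>c\<in>?T. rep (U - {0}) c * rep (V - {0}) c)"
    using fin finT by (simp add: card_cartesian_product rep_def)
  finally show ?thesis by (simp add: cross_energy_def Q_def)
qed

lemma card_translate: "card ((\<alpha>::real) +o A) = card A"
proof -
  have "\<alpha> +o A = (+) \<alpha> ` A" by (auto simp: elt_set_plus_def)
  then show ?thesis by (simp add: card_image)
qed

lemma finite_translate: "finite A \<Longrightarrow> finite ((\<alpha>::real) +o A)"
  by (simp add: elt_set_plus_def)

text \<open>\<open>T\<close> is left general so that the ratios of one translate can also be tested
  against another.\<close>

lemma sum_rep_squares_le:
  fixes A P T :: "real set" and M \<alpha> :: real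
  assumes fin: "finite A" "finite P" "finite T" and P0: "0 \<notin> P" and T0: "0 \<notin> T" and \<alpha>: "\<alpha> \<noteq> 0"
    and PA: "card P \<le> card A" "card A \<le> 2 * card P"
    and M: "M \<ge> 1" "real (card (A * P)) \<le> M * real (card A)"
    and A2: "card A \<ge> 2" and T: "card T \<le> (card A)\<^sup>2"
  shows "(\<Sum>c\<in>T. (real (rep ((\<alpha> +o A) - {0}) c))\<^sup>2)
      \<le> 32768 * M ^ 4 * (real (card A))\<^sup>2 * log 2 (real (card A))"
proof -
  define D where "D = 8192 * M ^ 4 * (real (card A))\<^sup>2"
  have M4: "1 \<le> M ^ 4" using M by simp
  have "(\<Sum>c\<in>T. (real (rep ((\<alpha> +o A) - {0}) c))\<^sup>2) \<le> 2 * D * (\<Sum>t=1..card A. 1 / real t)"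
  proof (rule sum_squares_le_tails[OF fin(3)])
    fix c
    have "rep ((\<alpha> +o A) - {0}) c \<le> card (\<alpha> +o A)"
      unfolding rep_def using fin by (intro card_mono) (auto simp: finite_translate)
    then show "rep ((\<alpha> +o A) - {0}) c \<le> card A" by (simp add: card_translate)
  next
    fix t :: nat assume t: "1 \<le> t"
    let ?S = "{c \<in> T. t \<le> rep ((\<alpha> +o A) - {0}) c}"
    show "real (card ?S) \<le> D / (real t)\<^sup>2"
    proof (cases "t = 1")
      \<comment> \<open>The popular-ratio bound requires t \<ge> 2; here the trivial bound by |T|
        suffices.\<close>
      case True
      have "card ?S \<le> card T" using fin by (intro card_mono) auto
      then have "real (card ?S) \<le> (real (card A))\<^sup>2"
        using T by (metis of_nat_mono of_nat_power order_trans)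
      also have "\<dots> \<le> D" using mult_right_mono[OF M4, of "(real (card A))\<^sup>2"]
          zero_le_power2[of "real (card A)"] unfolding D_def mult.assoc by linarith
      finally show ?thesis using True by simp
    next
      case False
      then show ?thesis unfolding D_def
        using fin P0 T0 \<alpha> PA M t by (intro card_popular_ratios_le[where P = P]) auto
    qed
  qed
  also have "\<dots> \<le> 2 * D * (2 * log 2 (real (card A)))"
    using sum_inverse_le_log[OF A2] M by (intro mult_left_mono) (auto simp: D_def)
  finally show ?thesis by (simp add: D_def)
qed

text \<open>The inequality r s \<le> (r^2 + s^2) / 2 separates the two translates. Zero products add
  at most 4 |A|^2, absorbed since M^4 log |A| \<ge> 1; hence 32772 = 32768 + 4.\<close>

lemma cross_energy_translates_le:
  fixes A P :: "real set" and M \<alpha> \<beta> :: real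
  assumes fin: "finite A" "finite P" and P0: "0 \<notin> P" and nz: "\<alpha> \<noteq> 0" "\<beta> \<noteq> 0"
    and PA: "card P \<le> card A" "card A \<le> 2 * card P"
    and M: "M \<ge> 1" "real (card (A * P)) \<le> M * real (card A)" and A2: "card A \<ge> 2"
  shows "real (cross_energy (\<alpha> +o A) (\<beta> +o A)) \<le> 32772 * M ^ 4 * (real (card A))\<^sup>2 * log 2 (real (card A))"
proof -
  define U V where "U = \<alpha> +o A" and "V = \<beta> +o A"
  have UV: "finite U" "finite V" "card U = card A" "card V = card A"
    using fin by (auto simp: U_def V_def finite_translate card_translate)
  define T where "T = ratio_set (U - {0}) (U - {0})"
  define B where "B = M ^ 4 * (real (card A))\<^sup>2 * log 2 (real (card A))"
  have T: "finite T" "0 \<notin> T" using UV by (auto simp: T_def finite_ratio_set) (auto simp: ratio_set_def)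
  have "card T \<le> card (U - {0}) * card (U - {0})"
    unfolding T_def using UV by (intro card_ratio_set_le) auto
  also have "\<dots> \<le> card U * card U" using UV by (intro mult_mono card_mono) auto
  finally have cT: "card T \<le> (card A)\<^sup>2" using UV by (simp add: power2_eq_square)
  let ?r = "\<lambda>c. real (rep (U - {0}) c)" and ?s = "\<lambda>c. real (rep (V - {0}) c)"
  have r: "(\<Sum>c\<in>T. (?r c)\<^sup>2) \<le> 32768 * B" and s: "(\<Sum>c\<in>T. (?s c)\<^sup>2) \<le> 32768 * B"
    using sum_rep_squares_le[OF fin T(1) P0 T(2) nz(1) PA M A2 cT]
      sum_rep_squares_le[OF fin T(1) P0 T(2) nz(2) PA M A2 cT] by (auto simp: B_def U_def V_def)
  have "(\<Sum>c\<in>T. ?r c * ?s c) \<le> (\<Sum>c\<in>T. ((?r c)\<^sup>2 + (?s c)\<^sup>2) / 2)"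
  proof (rule sum_mono)
    fix c show "?r c * ?s c \<le> ((?r c)\<^sup>2 + (?s c)\<^sup>2) / 2"
      using sum_squares_bound[of "?r c" "?s c"] by simp
  qed
  also have "\<dots> \<le> 32768 * B"
    using r s by (simp add: sum.distrib flip: sum_divide_distrib)
  finally have rs: "(\<Sum>c\<in>T. ?r c * ?s c) \<le> 32768 * B" .
  have "1 \<le> M ^ 4 * log 2 (real (card A))"
    using M A2 by (intro mult_ge1_I) auto
  then have B: "(real (card A))\<^sup>2 \<le> B"
    using mult_left_mono[of 1 "M ^ 4 * log 2 (real (card A))" "(real (card A))\<^sup>2"] by (simp add: B_def mult_ac)
  have "real (cross_energy U V) \<le> real ((card U + card V)\<^sup>2 + (\<Sum>c\<in>T. rep (U - {0}) c * rep (V - {0}) c))"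
    unfolding T_def by (intro of_nat_mono cross_energy_le UV)
  also have "\<dots> = 4 * (real (card A))\<^sup>2 + (\<Sum>c\<in>T. ?r c * ?s c)" using UV by (simp add: power2_eq_square)
  also have "\<dots> \<le> 32772 * B" using rs B by linarith
  finally show ?thesis by (simp add: B_def U_def V_def mult.assoc)
qed

section \<open>Consequences of a small product set or ratio set\<close>

lemma times_inverse_eq_ratio_set:
  fixes A :: "'a::field set"
  shows "A * inverse ` (A - {0}) = ratio_set A A"
  by (auto simp: set_times_image ratio_set_def divide_inverse image_iff)

text \<open>Discarding 0 loses at most one element, hence at most half of \<open>A\<close>. The
  rest, or its inverses, serves as \<open>P\<close>.\<close>

lemma obtains_multiplier:
  fixes A :: "real set"
  assumes fin: "finite A" and A2: "card A \<ge> 2"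
    and AA: "real (card (A * A)) \<le> M * real (card A) \<or> real (card (ratio_set A A)) \<le> M * real (card A)"
  obtains P where "finite P" "0 \<notin> P" "card P \<le> card A" "card A \<le> 2 * card P"
    "real (card (A * P)) \<le> M * real (card A)"
proof -
  let ?A = "A - {0}"
  have c: "card ?A \<le> card A" "card A \<le> 2 * card ?A"
    using diff_card_le_card_Diff[of "{0}" A] A2 fin by (auto intro: card_mono)
  from AA show ?thesis
  proof
    assume *: "real (card (A * A)) \<le> M * real (card A)"
    have "card (A * ?A) \<le> card (A * A)"
      using fin by (intro card_mono finite_set_times set_times_mono2) auto
    then show ?thesis using * fin c by (intro that[of ?A]) auto
  next
    assume *: "real (card (ratio_set A A)) \<le> M * real (card A)"
    have "card (inverse ` ?A) = card ?A" by (intro card_image) (simp add: inj_on_def)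
    then show ?thesis using * fin c
      by (intro that[of "inverse ` ?A"]) (auto simp: times_inverse_eq_ratio_set)
  qed
qed

text \<open>By Cauchy--Schwarz, multiplication or division on \<open>B \<times> B\<close> has at
  least |B|^4 / (M |A|) collisions, and each yields a pair in \<open>G z\<close> with z in
  \<open>B\<close>. Averaging over at most |A| values of z gives the bound; 16 = 2^4 comes from |B|
  \<ge> |A| / 2.\<close>

lemma obtains_popular_dilate:
  fixes A :: "real set"
  assumes fin: "finite A" and A2: "card A \<ge> 2" and M: "M \<ge> 1"
    and AA: "real (card (A * A)) \<le> M * real (card A) \<or> real (card (ratio_set A A)) \<le> M * real (card A)"
  obtains z where "z \<noteq> 0"
    "(real (card A))\<^sup>2 \<le> 16 * M * real (card {(u, v). u \<in> A \<and> v \<in> A \<and> u * v / z \<in> A})"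
proof -
  define B where "B = A - {0}"
  define G where "G z = {(u, v). u \<in> A \<and> v \<in> A \<and> u * v / z \<in> A}" for z
  have finB: "finite B" using fin by (simp add: B_def)
  have finG: "finite (G z)" for z
    by (rule finite_subset[of _ "A \<times> A"]) (use fin in \<open>auto simp: G_def\<close>)
  have B: "card B \<le> card A" "card A \<le> 2 * card B"
    using diff_card_le_card_Diff[of "{0}" A] A2 fin by (auto simp: B_def intro: card_mono)
  have finS: "finite (SIGMA z:B. G z)" using finB finG by auto
  have energy: "(real (card B) ^ 2)\<^sup>2 \<le> (M * real (card A)) * real (card (SIGMA z:B. G z))"
    using AA
  proof
    assume *: "real (card (A * A)) \<le> M * real (card A)"
    let ?f = "\<lambda>(u, v). u * v :: real"
    let ?C = "{(x, y). x \<in> B \<times> B \<and> y \<in> B \<times> B \<and> ?f x = ?f y}"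
    have "card ?C \<le> card (SIGMA z:B. G z)"
    proof (rule card_inj_on_le[OF _ _ finS])
      show "inj_on (\<lambda>((u, v), (u', v')). (u', (u, v))) ?C"
        by (auto simp: inj_on_def B_def)
      show "(\<lambda>((u, v), (u', v')). (u', (u, v))) ` ?C \<subseteq> (SIGMA z:B. G z)"
        by (auto simp: G_def B_def)
    qed
    moreover have "?f ` (B \<times> B) \<subseteq> A * A" by (auto simp: B_def)
    then have "card (?f ` (B \<times> B)) \<le> card (A * A)"
      using fin by (intro card_mono finite_set_times) auto
    ultimately have "real (card (?f ` (B \<times> B))) * real (card ?C) \<le> (M * real (card A)) * real (card (SIGMA z:B. G z))"
      using * M by (intro mult_mono) auto
    then show ?thesis
      using card_sq_le_collisions[of "B \<times> B" ?f] finB by (simp add: card_cartesian_product power2_eq_square)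
  next
    assume *: "real (card (ratio_set A A)) \<le> M * real (card A)"
    let ?f = "\<lambda>(u, v). u / v :: real"
    let ?C = "{(x, y). x \<in> B \<times> B \<and> y \<in> B \<times> B \<and> ?f x = ?f y}"
    have "card ?C \<le> card (SIGMA z:B. G z)"
    proof (rule card_inj_on_le[OF _ _ finS])
      \<comment> \<open>A collision of quotients reads u v' / u' = v, so the pair kept is (u, v')
        instead of (u, v).\<close>
      show "inj_on (\<lambda>((u, v), (u', v')). (u', (u, v'))) ?C"
        by (clarsimp simp: inj_on_def B_def) (metis divide_cancel_left)
      show "(\<lambda>((u, v), (u', v')). (u', (u, v'))) ` ?C \<subseteq> (SIGMA z:B. G z)"
      proof (rule image_subsetI)
        fix x assume "x \<in> ?C"
        then obtain u v u' v' where x: "x = ((u, v), (u', v'))" "u \<in> B" "v \<in> B" "u' \<in> B" "v' \<in> B"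
          and "u / v = u' / v'" by auto
        then have "u * v' / u' = v" by (auto simp: B_def field_simps)
        then show "(\<lambda>((u, v), (u', v')). (u', (u, v'))) x \<in> (SIGMA z:B. G z)"
          using x by (auto simp: G_def B_def)
      qed
    qed
    moreover have "?f ` (B \<times> B) \<subseteq> ratio_set A A" by (auto simp: B_def ratio_set_def)
    then have "card (?f ` (B \<times> B)) \<le> card (ratio_set A A)"
      using fin by (intro card_mono finite_ratio_set) auto
    ultimately have "real (card (?f ` (B \<times> B))) * real (card ?C) \<le> (M * real (card A)) * real (card (SIGMA z:B. G z))"
      using * M by (intro mult_mono) auto
    then show ?thesis
      using card_sq_le_collisions[of "B \<times> B" ?f] finB by (simp add: card_cartesian_product power2_eq_square)
  qed
  define a where "a = real (card A)"
  have a: "a > 0" using A2 by (simp add: a_def)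
  have "\<exists>z\<in>B. a\<^sup>2 \<le> 16 * M * real (card (G z))"
  proof (rule ccontr)
    assume neg: "\<not> ?thesis"
    have "B \<noteq> {}" using B A2 by auto
    have "16 * M * real (card (SIGMA z:B. G z)) = (\<Sum>z\<in>B. 16 * M * real (card (G z)))"
      using finB finG by (simp add: sum_distrib_left)
    also have "\<dots> < (\<Sum>z\<in>B. a\<^sup>2)"
      using neg finB \<open>B \<noteq> {}\<close> by (intro sum_strict_mono) auto
    also have "\<dots> \<le> a * a\<^sup>2" using B by (simp add: a_def mult_right_mono)
    finally have "a * (16 * M * real (card (SIGMA z:B. G z))) < a * (a * a\<^sup>2)" using a by (intro mult_strict_left_mono)
    moreover have "(a / 2) ^ 4 \<le> real (card B) ^ 4" using B a by (intro power_mono) (auto simp: a_def)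
    ultimately show False using energy by (simp add: power4_eq_xxxx power2_eq_square a_def mult_ac)
  qed
  then show ?thesis using that by (auto simp: B_def G_def a_def)
qed

section \<open>Lower bounds from energy by Cauchy--Schwarz\<close>

text \<open>An injective affine map sends the products (\<beta> z + u) (\<alpha> z + v) with (u, v)
  in \<open>G\<close> into the sumset, and collisions among these products are counted by the cross
  energy.\<close>

lemma sumset_card_times_energy_ge:
  fixes A :: "real set"
  assumes fin: "finite A" and z: "z \<noteq> 0"
  defines "G \<equiv> {(u, v). u \<in> A \<and> v \<in> A \<and> u * v / z \<in> A}"
  shows "(real (card G))\<^sup>2 \<le> real (card (A + (\<alpha> *o A) + (\<beta> *o A))) *
    real (cross_energy ((\<beta> * z) +o A) ((\<alpha> * z) +o A))"
proof -
  let ?f = "\<lambda>(u, v). (\<beta> * z + u) * (\<alpha> * z + v)"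
  let ?C = "{(x, y). x \<in> G \<and> y \<in> G \<and> ?f x = ?f y}"
  let ?U = "(\<beta> * z) +o A" and ?V = "(\<alpha> * z) +o A"
  have finG: "finite G" by (rule finite_subset[of _ "A \<times> A"]) (use fin in \<open>auto simp: G_def\<close>)
  have "card (?f ` G) \<le> card (A + (\<alpha> *o A) + (\<beta> *o A))"
  proof (rule card_inj_on_le)
    show "inj_on (\<lambda>w. w / z - \<alpha> * \<beta> * z) (?f ` G)" using z by (auto simp: inj_on_def)
    show "(\<lambda>w. w / z - \<alpha> * \<beta> * z) ` (?f ` G) \<subseteq> A + (\<alpha> *o A) + (\<beta> *o A)"
    proof (clarsimp simp: G_def)
      fix u v assume "u \<in> A" "v \<in> A" "u * v / z \<in> A"
      then have "u * v / z + \<alpha> * u + \<beta> * v \<in> A + (\<alpha> *o A) + (\<beta> *o A)" by blast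
      moreover have "(\<beta> * z + u) * (\<alpha> * z + v) / z - \<alpha> * \<beta> * z = u * v / z + \<alpha> * u + \<beta> * v"
        using z by (simp add: field_simps)
      ultimately show "(\<beta> * z + u) * (\<alpha> * z + v) / z - \<alpha> * \<beta> * z \<in> A + (\<alpha> *o A) + (\<beta> *o A)" by simp
    qed
    show "finite (A + (\<alpha> *o A) + (\<beta> *o A))"
      using fin by (intro finite_set_plus) (auto simp: elt_set_times_def)
  qed
  moreover have "card ?C \<le> cross_energy ?U ?V"
    unfolding cross_energy_def
  proof (rule card_inj_on_le)
    show "inj_on (\<lambda>((u, v), (u', v')). (\<beta> * z + u, \<alpha> * z + v, \<beta> * z + u', \<alpha> * z + v')) ?C"
      by (auto simp: inj_on_def)
    show "(\<lambda>((u, v), (u', v')). (\<beta> * z + u, \<alpha> * z + v, \<beta> * z + u', \<alpha> * z + v')) ` ?C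
        \<subseteq> {(u, v, u', v'). u \<in> ?U \<and> v \<in> ?V \<and> u' \<in> ?U \<and> v' \<in> ?V \<and> u * v = u' * v'}"
      by (auto simp: G_def)
    show "finite {(u, v, u', v'). u \<in> ?U \<and> v \<in> ?V \<and> u' \<in> ?U \<and> v' \<in> ?V \<and> u * v = u' * v'}"
      by (rule finite_subset[of _ "?U \<times> ?V \<times> ?U \<times> ?V"]) (use fin in \<open>auto simp: finite_translate\<close>)
  qed
  ultimately have "real (card (?f ` G)) * real (card ?C) \<le>
      real (card (A + (\<alpha> *o A) + (\<beta> *o A))) * real (cross_energy ?U ?V)"
    by (intro mult_mono) auto
  then show ?thesis using card_sq_le_collisions[OF finG, of ?f] by linarith
qed

lemma productset_card_times_energy_ge:
  fixes U :: "real set"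
  assumes "finite U"
  shows "real (card U) ^ 4 \<le> real (card (U * U)) * real (mult_energy U)"
proof -
  let ?f = "\<lambda>(u, v). u * v :: real"
  let ?C = "{(x, y). x \<in> U \<times> U \<and> y \<in> U \<times> U \<and> ?f x = ?f y}"
  let ?Q = "{(u, v, u', v'). u \<in> U \<and> v \<in> U \<and> u' \<in> U \<and> v' \<in> U \<and> u * v = u' * v'}"
  have "card ?C \<le> mult_energy U"
    unfolding mult_energy_def
  proof (rule card_inj_on_le)
    show "inj_on (\<lambda>((u, v), (u', v')). (u, v, u', v')) ?C" by (auto simp: inj_on_def)
    show "(\<lambda>((u, v), (u', v')). (u, v, u', v')) ` ?C \<subseteq> ?Q" by auto
    show "finite ?Q" by (rule finite_subset[of _ "U \<times> U \<times> U \<times> U"]) (use assms in auto)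
  qed
  moreover have "?f ` (U \<times> U) = U * U" by (simp add: set_times_image)
  ultimately have "real (card (?f ` (U \<times> U))) * real (card ?C) \<le> real (card (U * U)) * real (mult_energy U)"
    by (intro mult_mono) auto
  then show ?thesis
    using card_sq_le_collisions[of "U \<times> U" ?f] assms
    by (simp add: card_cartesian_product power2_eq_square power4_eq_xxxx mult_ac)
qed

text \<open>Subtract 1 from (1 + u) (1 + v) to get u v + u + v.\<close>

lemma card_shifted_product_le:
  fixes A :: "real set"
  assumes fin: "finite A"
  shows "card ((1 +o A) * (1 +o A)) \<le> card (A * A + A + A)"
proof (rule card_inj_on_le)
  show "inj_on (\<lambda>w. w - 1) ((1 +o A) * (1 +o A))" by (auto simp: inj_on_def)
  show "(\<lambda>w. w - 1) ` ((1 +o A) * (1 +o A)) \<subseteq> A * A + A + A"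
  proof (rule image_subsetI)
    fix w assume "w \<in> (1 +o A) * (1 +o A)"
    then obtain u v where "w = (1 + u) * (1 + v)" and uv: "u \<in> A" "v \<in> A"
      by (auto simp: set_times_image elt_set_plus_def)
    then have "w - 1 = u * v + u + v" by (simp add: algebra_simps)
    also have "\<dots> \<in> A * A + A + A" using uv by blast
    finally show "w - 1 \<in> A * A + A + A" .
  qed
  show "finite (A * A + A + A)" using fin by (intro finite_set_plus finite_set_times)
qed

lemma divide_le_if_le_mult:
  fixes a b c x y :: real
  assumes "a \<le> x * y" "y \<le> b" "0 < b" "0 \<le> x"
  shows "a / b \<le> x"
proof -
  have "a \<le> x * b" using assms by (meson mult_left_mono order_trans)
  then show ?thesis using assms by (simp add: field_simps)
qed

section \<open>Assembly of the three bounds\<close>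

theorem theorem12:
  shows "\<exists>C::real. C > 0 \<and>
    (\<forall>(A::real set) (M::real).
       finite A \<and> card A \<ge> 2 \<and> M \<ge> 1 \<and>
       (real (card (A * A)) \<le> M * real (card A) \<or>
        real (card (ratio_set A A)) \<le> M * real (card A)) \<longrightarrow>
       (\<forall>\<alpha>::real. \<alpha> \<noteq> 0 \<longrightarrow>
          real (mult_energy (\<alpha> +o A)) \<le> C * M ^ 4 * real (card A) ^ 2 * log 2 (real (card A))) \<and>
       (card (A * A + A + A) \<ge> card ((1 +o A) * (1 +o A)) \<and>
        real (card ((1 +o A) * (1 +o A))) \<ge>
          inverse C * (real (card A) ^ 2 / (M ^ 4 * log 2 (real (card A))))) \<and>
       (\<forall>\<alpha> \<beta>::real. \<alpha> \<noteq> 0 \<and> \<beta> \<noteq> 0 \<longrightarrow>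
          real (card (A + (\<alpha> *o A) + (\<beta> *o A))) \<ge>
            inverse C * (real (card A) ^ 2 / (M ^ 6 * log 2 (real (card A))))))"
proof (intro exI[of _ "2 ^ 24"] conjI allI impI; (elim conjE)?)
  fix A :: "real set" and M :: real
  assume fin: "finite A" and A2: "card A \<ge> 2" and M: "M \<ge> 1"
    and AA: "real (card (A * A)) \<le> M * real (card A) \<or> real (card (ratio_set A A)) \<le> M * real (card A)"
  obtain P where P: "finite P" "0 \<notin> P" "card P \<le> card A" "card A \<le> 2 * card P"
    "real (card (A * P)) \<le> M * real (card A)"
    using obtains_multiplier[OF fin A2 AA] .
  define a where "a = real (card A)"
  \<comment> \<open>2^16 rounds up 32772. The remaining 2^8 in 2^24 is the square of the factor 16
    lost in choosing z for (iii).\<close>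
  define B where "B = 2 ^ 16 * M ^ 4 * a\<^sup>2 * log 2 a"
  have a: "a \<ge> 2" using A2 by (simp add: a_def)
  have B0: "B > 0" using a M by (simp add: B_def)
  have energy: "real (cross_energy (\<alpha> +o A) (\<beta> +o A)) \<le> B" if "\<alpha> \<noteq> 0" "\<beta> \<noteq> 0" for \<alpha> \<beta>
  proof -
    have "real (cross_energy (\<alpha> +o A) (\<beta> +o A)) \<le> 32772 * M ^ 4 * a\<^sup>2 * log 2 a"
      unfolding a_def using fin P that M A2 by (intro cross_energy_translates_le)
    also have "\<dots> \<le> B" unfolding B_def using M a by (intro mult_right_mono) auto
    finally show ?thesis .
  qed
  show "real (mult_energy (\<alpha> +o A)) \<le> 2 ^ 24 * M ^ 4 * real (card A) ^ 2 * log 2 (real (card A))"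
    if "\<alpha> \<noteq> 0" for \<alpha>
    using energy[OF that that] B0 by (simp add: B_def a_def mult_energy_eq_cross_energy)
  show "card ((1 +o A) * (1 +o A)) \<le> card (A * A + A + A)"
    by (rule card_shifted_product_le[OF fin])
  have "a ^ 4 / B \<le> real (card ((1 +o A) * (1 +o A)))"
    using productset_card_times_energy_ge[OF finite_translate[OF fin], of 1] energy[of 1 1] B0
    by (intro divide_le_if_le_mult) (auto simp: card_translate a_def mult_energy_eq_cross_energy)
  moreover have "inverse (2 ^ 24) * (a ^ 2 / (M ^ 4 * log 2 a)) \<le> a ^ 4 / B"
    using a M by (simp add: B_def field_simps power2_eq_square power4_eq_xxxx)
  ultimately show "inverse (2 ^ 24) * (real (card A) ^ 2 / (M ^ 4 * log 2 (real (card A))))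
      \<le> real (card ((1 +o A) * (1 +o A)))"
    by (simp add: a_def)
  fix \<alpha> \<beta> :: real
  assume nz: "\<alpha> \<noteq> 0" "\<beta> \<noteq> 0"
  let ?S = "A + (\<alpha> *o A) + (\<beta> *o A)"
  obtain z where z: "z \<noteq> 0"
    and G: "a\<^sup>2 \<le> 16 * M * real (card {(u, v). u \<in> A \<and> v \<in> A \<and> u * v / z \<in> A})"
    using obtains_popular_dilate[OF fin A2 M AA] unfolding a_def .
  let ?g = "real (card {(u, v). u \<in> A \<and> v \<in> A \<and> u * v / z \<in> A})"
  \<comment> \<open>Both shifts \<beta> z and \<alpha> z are nonzero, so the energy bound applies.
    Squaring the lower bound a^2 / (16 M) for \<open>?g\<close> below turns M^4 into M^6.\<close>
  have "?g\<^sup>2 / B \<le> real (card ?S)"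
    using sumset_card_times_energy_ge[OF fin z, of \<alpha> \<beta>] energy[of "\<beta> * z" "\<alpha> * z"] z nz B0
    by (intro divide_le_if_le_mult) auto
  moreover have "a ^ 2 / (16 * M) \<le> ?g" using G M by (simp add: field_simps)
  then have "(a ^ 2 / (16 * M))\<^sup>2 \<le> ?g\<^sup>2" using M by (intro power_mono) auto
  then have "(a ^ 2 / (16 * M))\<^sup>2 / B \<le> ?g\<^sup>2 / B" using B0 by (intro divide_right_mono) auto
  moreover have "inverse (2 ^ 24) * (a ^ 2 / (M ^ 6 * log 2 a)) = (a ^ 2 / (16 * M))\<^sup>2 / B"
  proof -
    have "M ^ 6 = M ^ 4 * M\<^sup>2" by (simp flip: power_add)
    then show ?thesis using a M by (simp add: B_def power_divide power_mult_distrib) (simp add: field_simps power2_eq_square power4_eq_xxxx)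
  qed
  ultimately show "inverse (2 ^ 24) * (real (card A) ^ 2 / (M ^ 6 * log 2 (real (card A)))) \<le> real (card ?S)"
    by (simp add: a_def)
qed simp

end
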